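(* Let $\gamma$ be a smooth closed plane curve without affine inflexions, parametrized by affine arclength $s$, with affine curvature $\mu$, and let $\alpha\in(0,1]$. Let $$X(s)=\gamma(s)+\frac{\alpha}{(1-\alpha)^2+\mu(s)\alpha^2}\left((1-\alpha)\gamma_s(s)+\alpha\gamma_{ss}(s)\right)$$ be the envelope of the family of lines $L_\alpha$ through $\gamma(s)$ with direction $(1-\alpha)\gamma_s+\alpha\gamma_{ss}$. Then the envelope $X$ is not regular at $s$ (that is, $X_s(s)=0$) if and only if $$\mu_s(s)=\frac{(1-\alpha)\left((1-\alpha)^2+\mu(s)\alpha^2\right)}{\alpha^3},$$ where $\mu_s$ is the derivative of the affine curvature with respect to $s$.
   Context: For $u,v\in\mathbb{R}^2$, $[u,v]$ denotes the determinant with columns $u,v$; subscripts denote derivatives. A curve is parametrized by affine arclength $s$ if $[\gamma_s,\gamma_{ss}]=1$ for all $s$; then $\gamma_{sss}=-\mu\gamma_s$, where $\mu=[\gamma_{ss},\gamma_{sss}]$ is the affine curvature. "Closed" means that $\gamma$ is a smooth periodic function of $s$. An affine inflexion is a point where $\mu=0$, so "without affine inflexions" means $\mu$ is nowhere zero. Under these assumptions $(1-\alpha)^2+\mu(s)\alpha^2\neq 0$ for all $s$. The envelope of the family $F(X,s)=[X-\gamma(s),(1-\alpha)\gamma_s(s)+\alpha\gamma_{ss}(s)]$ ($\alpha$ fixed) is the set of $X\in\mathbb{R}^2$ for which there is $s$ with $F(X,s)=F_s(X,s)=0$. *)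

theory Defs
  imports "HOL-Analysis.Analysis"
begin

definition bracket :: "real^2 \<Rightarrow> real^2 \<Rightarrow> real" where
  "bracket u v = det (transpose (vector [u, v]) :: real^2^2)"
  \<comment> \<open>\<open>vector [u, v]\<close> has rows \<open>u\<close>, \<open>v\<close>; its transpose has these as columns\<close>

definition vderiv :: "(real \<Rightarrow> real^2) \<Rightarrow> real \<Rightarrow> real^2" where
  "vderiv \<gamma> s = vector_derivative \<gamma> (at s)"

text \<open>\<open>vector_derivative\<close> is unspecified at points of non-differentiability. Under the next
  predicate this never happens for the curve and its iterated derivatives.\<close>

definition smooth_curve :: "(real \<Rightarrow> real^2) \<Rightarrow> bool" where
  "smooth_curve \<gamma> \<longleftrightarrow> (\<forall>n s. (vderiv ^^ n) \<gamma> differentiable (at s))"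

definition closed_curve :: "(real \<Rightarrow> real^2) \<Rightarrow> bool" where
  "closed_curve \<gamma> \<longleftrightarrow> (\<exists>T>0. \<forall>s. \<gamma> (s + T) = \<gamma> s)"

definition affine_arclength_parametrized :: "(real \<Rightarrow> real^2) \<Rightarrow> bool" where
  "affine_arclength_parametrized \<gamma> \<longleftrightarrow>
     (\<forall>s. bracket (vderiv \<gamma> s) ((vderiv ^^ 2) \<gamma> s) = 1)"

definition affine_curvature :: "(real \<Rightarrow> real^2) \<Rightarrow> real \<Rightarrow> real" where
  "affine_curvature \<gamma> s = bracket ((vderiv ^^ 2) \<gamma> s) ((vderiv ^^ 3) \<gamma> s)"

definition line_direction :: "(real \<Rightarrow> real^2) \<Rightarrow> real \<Rightarrow> real \<Rightarrow> real^2" where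
  "line_direction \<gamma> \<alpha> s = (1 - \<alpha>) *\<^sub>R vderiv \<gamma> s + \<alpha> *\<^sub>R (vderiv ^^ 2) \<gamma> s"

definition line_family :: "(real \<Rightarrow> real^2) \<Rightarrow> real \<Rightarrow> real^2 \<Rightarrow> real \<Rightarrow> real" where
  "line_family \<gamma> \<alpha> Y s = bracket (Y - \<gamma> s) (line_direction \<gamma> \<alpha> s)"

definition envelope :: "(real^2 \<Rightarrow> real \<Rightarrow> real) \<Rightarrow> (real^2) set" where
  "envelope F = {Y. \<exists>s. F Y s = 0 \<and> (F Y has_real_derivative 0) (at s)}"

end

theory Submission
  imports Defs
begin

text \<open>
  Write \<open>d = (1 - \<alpha>) \<gamma>\<^sub>s + \<alpha> \<gamma>\<^sub>s\<^sub>s\<close> for the direction of the line through \<open>\<gamma>(s)\<close> and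
  \<open>D = (1 - \<alpha>)\<^sup>2 + \<mu> \<alpha>\<^sup>2\<close>. The structure equation \<open>\<gamma>\<^sub>s\<^sub>s\<^sub>s = - \<mu> \<gamma>\<^sub>s\<close> gives \<open>[d, d\<^sub>s] = D\<close> and
  \<open>[\<gamma>\<^sub>s, d] = \<alpha>\<close>. For any moving line with \<open>[d, d\<^sub>s] \<noteq> 0\<close> the two equations of the envelope have
  the single solution \<open>\<gamma> + ([\<gamma>\<^sub>s, d] / [d, d\<^sub>s]) d\<close> (\<open>envelope_conditions_iff\<close>), which here is \<open>X(s)\<close>.
  Expanding \<open>X\<^sub>s\<close> in the frame \<open>\<gamma>\<^sub>s, \<gamma>\<^sub>s\<^sub>s\<close>, the coefficient of \<open>\<gamma>\<^sub>s\<^sub>s\<close> vanishes exactly when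
  \<open>\<mu>\<^sub>s = (1 - \<alpha>) D / \<alpha>\<^sup>3\<close>, and for this value of \<open>\<mu>\<^sub>s\<close> the coefficient of \<open>\<gamma>\<^sub>s\<close> vanishes as well.

  All this needs \<open>D \<noteq> 0\<close>, and here the closedness of the curve enters. The periodic function
  \<open>\<gamma>\<^sub>s \<bullet> \<gamma>\<^sub>s\<^sub>s\<close> has the derivative \<open>|\<gamma>\<^sub>s\<^sub>s|\<^sup>2 - \<mu> |\<gamma>\<^sub>s|\<^sup>2\<close>, which must vanish somewhere by Rolle's
  theorem; hence \<open>\<mu> \<ge> 0\<close> there, and a continuous \<open>\<mu>\<close> without zeros is then positive everywhere
  (\<open>affine_curvature_pos\<close>).
\<close>

section \<open>The determinant bracket\<close>

lemma bracket_components: "bracket u v = u $ 1 * v $ 2 - v $ 1 * u $ 2"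
  by (simp add: bracket_def det_2 transpose_def)

lemma bracket_add_left: "bracket (u + v) w = bracket u w + bracket v w"
  and bracket_add_right: "bracket w (u + v) = bracket w u + bracket w v"
  and bracket_diff_left: "bracket (u - v) w = bracket u w - bracket v w"
  and bracket_diff_right: "bracket w (u - v) = bracket w u - bracket w v"
  and bracket_scaleR_left: "bracket (c *\<^sub>R u) w = c * bracket u w"
  and bracket_scaleR_right: "bracket w (c *\<^sub>R u) = c * bracket w u"
  and bracket_self: "bracket u u = 0"
  and bracket_swap: "bracket v u = - bracket u v"
  by (simp_all add: bracket_components algebra_simps)

lemmas bracket_simps = bracket_add_left bracket_add_right bracket_diff_left
  bracket_diff_right bracket_scaleR_left bracket_scaleR_right bracket_self

text \<open>Cramer's rule: a vector is determined by its brackets with the two vectors of a basis.\<close>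

lemma bracket_eq_iff:
  assumes "bracket u v \<noteq> 0"
  shows "w = z \<longleftrightarrow> bracket w u = bracket z u \<and> bracket w v = bracket z v"
proof
  assume eqs: "bracket w u = bracket z u \<and> bracket w v = bracket z v"
  have cramer: "bracket u v *\<^sub>R y = bracket y v *\<^sub>R u - bracket y u *\<^sub>R v" for y
    by (simp add: vec_eq_iff forall_2 bracket_components algebra_simps)
  have "bracket u v *\<^sub>R w = bracket u v *\<^sub>R z"
    using eqs by (simp add: cramer)
  then show "w = z" using assms by simp
qed simp

lemma has_real_derivative_bracket:
  assumes "(f has_vector_derivative f') (at s)" "(g has_vector_derivative g') (at s)"
  shows "((\<lambda>t. bracket (f t) (g t)) has_real_derivative bracket f' (g s) + bracket (f s) g') (at s)"
proof -
  have comp: "((\<lambda>t. h t $ i) has_real_derivative h' $ i) (at s)"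
    if "(h has_vector_derivative h') (at s)" for h :: "real \<Rightarrow> real^2" and h' i
    using bounded_linear.has_vector_derivative[OF bounded_linear_vec_nth that]
    by (simp add: has_real_derivative_iff_has_vector_derivative)
  show ?thesis
    unfolding bracket_components
    using DERIV_diff[OF DERIV_mult[OF comp[OF assms(1), of 1] comp[OF assms(2), of 2]]
        DERIV_mult[OF comp[OF assms(2), of 1] comp[OF assms(1), of 2]]]
    by (simp add: algebra_simps)
qed

section \<open>Envelopes of moving lines\<close>

text \<open>The conditions prescribe the brackets of \<open>Y - \<gamma> s\<close> with \<open>d s\<close> and \<open>d'\<close>: the line condition
  is \<open>[Y - \<gamma>, d] = 0\<close>, and its \<open>s\<close>-derivative is \<open>[Y - \<gamma>, d'] - [\<gamma>', d]\<close>.\<close>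

lemma envelope_conditions_iff:
  assumes \<gamma>: "(\<gamma> has_vector_derivative \<gamma>') (at s)"
    and d: "(d has_vector_derivative d') (at s)"
    and indep: "bracket (d s) d' \<noteq> 0"
  shows "bracket (Y - \<gamma> s) (d s) = 0 \<and>
           ((\<lambda>t. bracket (Y - \<gamma> t) (d t)) has_real_derivative 0) (at s) \<longleftrightarrow>
         Y = \<gamma> s + (bracket \<gamma>' (d s) / bracket (d s) d') *\<^sub>R d s"
proof -
  have "((\<lambda>t. Y - \<gamma> t) has_vector_derivative - \<gamma>') (at s)"
    using \<gamma> by (auto intro!: derivative_eq_intros)
  from has_real_derivative_bracket[OF this d]
  have deriv: "((\<lambda>t. bracket (Y - \<gamma> t) (d t)) has_real_derivative
      bracket (- \<gamma>') (d s) + bracket (Y - \<gamma> s) d') (at s)" .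
  have "((\<lambda>t. bracket (Y - \<gamma> t) (d t)) has_real_derivative 0) (at s) \<longleftrightarrow>
      bracket (Y - \<gamma> s) d' = bracket \<gamma>' (d s)"
    using deriv DERIV_unique[OF deriv, of 0] bracket_scaleR_left[of "-1" \<gamma>' "d s"] by auto
  moreover have "Y = \<gamma> s + c *\<^sub>R d s \<longleftrightarrow> Y - \<gamma> s = c *\<^sub>R d s" for c
    by (auto simp: algebra_simps)
  ultimately show ?thesis
    using indep by (simp add: bracket_eq_iff[OF indep, of "Y - \<gamma> s"] bracket_simps)
qed

section \<open>Curves parametrized by affine arclength\<close>

lemma smooth_curve_has_vector_derivative:
  assumes "smooth_curve \<gamma>"
  shows "((vderiv ^^ n) \<gamma> has_vector_derivative (vderiv ^^ Suc n) \<gamma> s) (at s)"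
proof -
  have "(vderiv ^^ n) \<gamma> differentiable (at s)"
    using assms by (simp add: smooth_curve_def)
  then show ?thesis
    by (simp add: vector_derivative_works vderiv_def)
qed

text \<open>Differentiating \<open>[\<gamma>\<^sub>s, \<gamma>\<^sub>s\<^sub>s] = 1\<close> gives \<open>[\<gamma>\<^sub>s, \<gamma>\<^sub>s\<^sub>s\<^sub>s] = 0\<close>, so \<open>\<gamma>\<^sub>s\<^sub>s\<^sub>s\<close> is a multiple of
  \<open>\<gamma>\<^sub>s\<close>, and its bracket with \<open>\<gamma>\<^sub>s\<^sub>s\<close> determines the factor.\<close>

lemma affine_structure_equation:
  assumes "smooth_curve \<gamma>" "affine_arclength_parametrized \<gamma>"
  shows "(vderiv ^^ 3) \<gamma> s = - affine_curvature \<gamma> s *\<^sub>R vderiv \<gamma> s"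
proof -
  have unit: "bracket (vderiv \<gamma> t) ((vderiv ^^ 2) \<gamma> t) = 1" for t
    using assms(2) by (simp add: affine_arclength_parametrized_def)
  have "((\<lambda>t. bracket ((vderiv ^^ 1) \<gamma> t) ((vderiv ^^ 2) \<gamma> t)) has_real_derivative
      bracket ((vderiv ^^ Suc 1) \<gamma> s) ((vderiv ^^ 2) \<gamma> s)
      + bracket ((vderiv ^^ 1) \<gamma> s) ((vderiv ^^ Suc 2) \<gamma> s)) (at s)"
    by (intro has_real_derivative_bracket smooth_curve_has_vector_derivative assms)
  then have "((\<lambda>t. 1) has_real_derivative bracket (vderiv \<gamma> s) ((vderiv ^^ 3) \<gamma> s)) (at s)"
    using unit by (simp add: bracket_self eval_nat_numeral)
  then have "bracket (vderiv \<gamma> s) ((vderiv ^^ 3) \<gamma> s) = 0"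
    by (rule DERIV_unique) simp
  then show ?thesis
    using unit[of s] bracket_eq_iff[of "vderiv \<gamma> s" "(vderiv ^^ 2) \<gamma> s"]
      bracket_swap[of "vderiv \<gamma> s" "(vderiv ^^ 3) \<gamma> s"]
      bracket_swap[of "(vderiv ^^ 2) \<gamma> s" "(vderiv ^^ 3) \<gamma> s"]
    by (simp add: bracket_scaleR_left bracket_self affine_curvature_def del: scaleR_minus_left)
qed

lemma affine_curvature_has_real_derivative:
  assumes "smooth_curve \<gamma>"
  shows "(affine_curvature \<gamma> has_real_derivative deriv (affine_curvature \<gamma>) s) (at s)"
proof -
  have "((\<lambda>t. bracket ((vderiv ^^ 2) \<gamma> t) ((vderiv ^^ 3) \<gamma> t)) has_real_derivative
      bracket ((vderiv ^^ Suc 2) \<gamma> s) ((vderiv ^^ 3) \<gamma> s)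
      + bracket ((vderiv ^^ 2) \<gamma> s) ((vderiv ^^ Suc 3) \<gamma> s)) (at s)"
    by (intro has_real_derivative_bracket smooth_curve_has_vector_derivative assms)
  then have "affine_curvature \<gamma> differentiable (at s)"
    unfolding affine_curvature_def[abs_def] real_differentiable_def by (rule exI)
  then show ?thesis
    by (simp add: DERIV_deriv_iff_real_differentiable)
qed

lemma vderiv_periodic:
  assumes "smooth_curve \<gamma>" "\<And>s. \<gamma> (s + T) = \<gamma> s"
  shows "(vderiv ^^ n) \<gamma> (s + T) = (vderiv ^^ n) \<gamma> s"
proof (induction n arbitrary: s)
  case (Suc n)
  let ?g = "(vderiv ^^ n) \<gamma>"
  have "((\<lambda>t. t + T) has_vector_derivative 1) (at s)"
    by (auto intro!: derivative_eq_intros)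
  from vector_diff_chain_at[OF this smooth_curve_has_vector_derivative[OF assms(1)], of n]
  have "((\<lambda>t. ?g (t + T)) has_vector_derivative (vderiv ^^ Suc n) \<gamma> (s + T)) (at s)"
    by (simp add: o_def)
  then have "(?g has_vector_derivative (vderiv ^^ Suc n) \<gamma> (s + T)) (at s)"
    using Suc.IH by simp
  then show ?case
    by (rule vector_derivative_unique_at) (rule smooth_curve_has_vector_derivative[OF assms(1)])
qed (use assms(2) in simp)

text \<open>Wherever \<open>\<mu> < 0\<close>, the function \<open>\<gamma>\<^sub>s \<bullet> \<gamma>\<^sub>s\<^sub>s\<close> is strictly increasing. Being periodic, it
  cannot increase all the time, so \<open>\<mu>\<close> is not negative throughout; as \<open>\<mu>\<close> has no zeros, it is
  nowhere negative.\<close>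

lemma affine_curvature_pos:
  assumes smooth: "smooth_curve \<gamma>" and closed: "closed_curve \<gamma>"
    and arclength: "affine_arclength_parametrized \<gamma>"
    and no_inflexion: "\<And>s. affine_curvature \<gamma> s \<noteq> 0"
  shows "affine_curvature \<gamma> s > 0"
proof -
  let ?\<mu> = "affine_curvature \<gamma>"
  obtain T where T: "T > 0" "\<And>s. \<gamma> (s + T) = \<gamma> s"
    using closed by (auto simp: closed_curve_def)
  define g where "g t = vderiv \<gamma> t \<bullet> (vderiv ^^ 2) \<gamma> t" for t
  define g' where "g' t = (norm ((vderiv ^^ 2) \<gamma> t))\<^sup>2 - ?\<mu> t * (norm (vderiv \<gamma> t))\<^sup>2" for t
  have g_deriv: "(g has_real_derivative g' t) (at t)" for t
  proof -
    have "((\<lambda>t. (vderiv ^^ 1) \<gamma> t \<bullet> (vderiv ^^ 2) \<gamma> t) has_vector_derivative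
        (vderiv ^^ 1) \<gamma> t \<bullet> (vderiv ^^ Suc 2) \<gamma> t + (vderiv ^^ Suc 1) \<gamma> t \<bullet> (vderiv ^^ 2) \<gamma> t) (at t)"
      by (intro bounded_bilinear.has_vector_derivative[OF bounded_bilinear_inner]
          smooth_curve_has_vector_derivative smooth)
    moreover have "(vderiv ^^ Suc 2) \<gamma> t = - ?\<mu> t *\<^sub>R vderiv \<gamma> t"
      using affine_structure_equation[OF smooth arclength, of t] by (simp add: eval_nat_numeral)
    moreover have "(vderiv ^^ Suc 1) \<gamma> t = (vderiv ^^ 2) \<gamma> t"
      by (simp add: eval_nat_numeral)
    ultimately show ?thesis
      by (simp add: g_def[abs_def] g'_def power2_norm_eq_inner
          has_real_derivative_iff_has_vector_derivative)
  qed
  have "g 0 = g T"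
    using vderiv_periodic[OF smooth T(2), of 1 0] vderiv_periodic[OF smooth T(2), of 2 0]
    by (simp add: g_def)
  moreover have "continuous_on {0..T} g"
    using g_deriv by (meson DERIV_isCont continuous_at_imp_continuous_on)
  \<comment> \<open>A Frechet derivative \<open>h \<mapsto> g' z * h\<close> is zero if and only if its value at \<open>1\<close> is.\<close>
  ultimately obtain z where "g' z = 0"
    using Rolle_deriv[OF T(1), of g "\<lambda>t h. g' t * h"] g_deriv
    by (auto simp: has_field_derivative_def dest: fun_cong[where x = 1])
  then have "?\<mu> z * (norm (vderiv \<gamma> z))\<^sup>2 = (norm ((vderiv ^^ 2) \<gamma> z))\<^sup>2"
    by (simp add: g'_def)
  moreover have "vderiv \<gamma> z \<noteq> 0"
    using arclength by (auto simp: affine_arclength_parametrized_def bracket_components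
        dest!: spec[of _ z])
  ultimately have "?\<mu> z \<ge> 0"
    using mult_neg_pos[of "?\<mu> z" "(norm (vderiv \<gamma> z))\<^sup>2"]
      zero_le_power2[of "norm ((vderiv ^^ 2) \<gamma> z)"] by fastforce
  then have "?\<mu> z > 0"
    using no_inflexion[of z] by simp
  moreover have "connected (range ?\<mu>)"
    using affine_curvature_has_real_derivative[OF smooth]
    by (intro connected_continuous_image continuous_at_imp_continuous_on)
       (auto intro: DERIV_isCont)
  ultimately have "0 \<in> range ?\<mu>" if "?\<mu> s \<le> 0"
    using connectedD_interval[of "range ?\<mu>" "?\<mu> s" "?\<mu> z" 0] that by simp
  then show ?thesis
    using no_inflexion by (metis imageE not_le)
qed

section \<open>Singular points of the envelope\<close>

text \<open>In the frame \<open>\<gamma>\<^sub>s, \<gamma>\<^sub>s\<^sub>s\<close> the coordinates of \<open>X\<^sub>s\<close> are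
  \<open>1 + (1 - \<alpha>) c' - \<alpha> \<mu> c\<close> and \<open>(1 - \<alpha>) c + \<alpha> c'\<close> with \<open>c = \<alpha> / D\<close> and \<open>c' = - \<alpha>\<^sup>3 \<mu>\<^sub>s / D\<^sup>2\<close>.
  The second one alone fixes \<open>\<mu>\<^sub>s\<close>. For this value \<open>c' = - (1 - \<alpha>) / D\<close>, and the first one becomes
  \<open>1 - ((1 - \<alpha>)\<^sup>2 + \<mu> \<alpha>\<^sup>2) / D = 0\<close>.\<close>

lemma singularity_equations_iff:
  fixes \<alpha> \<mu> \<mu>' :: real
  defines "D \<equiv> (1 - \<alpha>)\<^sup>2 + \<mu> * \<alpha>\<^sup>2"
  assumes "\<alpha> \<noteq> 0" "D \<noteq> 0"
  shows "1 + (1 - \<alpha>) * (- (\<alpha> ^ 3 * \<mu>') / D\<^sup>2) - \<alpha> * \<mu> * (\<alpha> / D) = 0 \<and>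
      (1 - \<alpha>) * (\<alpha> / D) + \<alpha> * (- (\<alpha> ^ 3 * \<mu>') / D\<^sup>2) = 0 \<longleftrightarrow>
    \<mu>' = (1 - \<alpha>) * D / \<alpha> ^ 3"
proof -
  have second: "(1 - \<alpha>) * (\<alpha> / D) + \<alpha> * (- (\<alpha> ^ 3 * \<mu>') / D\<^sup>2)
      = \<alpha> / D\<^sup>2 * ((1 - \<alpha>) * D - \<alpha> ^ 3 * \<mu>')"
    using assms(3) by (simp add: field_simps power2_eq_square)
  have "1 + (1 - \<alpha>) * (- (\<alpha> ^ 3 * \<mu>') / D\<^sup>2) - \<alpha> * \<mu> * (\<alpha> / D) = 0"
    if "\<alpha> ^ 3 * \<mu>' = (1 - \<alpha>) * D"
  proof -
    have "1 + (1 - \<alpha>) * (- (\<alpha> ^ 3 * \<mu>') / D\<^sup>2) - \<alpha> * \<mu> * (\<alpha> / D)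
        = (D - ((1 - \<alpha>)\<^sup>2 + \<mu> * \<alpha>\<^sup>2)) / D"
      unfolding that using assms(3) by (simp add: field_simps power2_eq_square)
    then show ?thesis by (simp add: D_def)
  qed
  moreover have "\<mu>' = (1 - \<alpha>) * D / \<alpha> ^ 3 \<longleftrightarrow> \<alpha> ^ 3 * \<mu>' = (1 - \<alpha>) * D"
    using assms(2) by (simp add: field_simps)
  ultimately show ?thesis
    unfolding second using assms(2,3) by auto
qed

theorem proposition3:
  fixes \<gamma> X :: "real \<Rightarrow> real^2" and \<mu> :: "real \<Rightarrow> real" and \<alpha> :: real
  assumes "smooth_curve \<gamma>" and "closed_curve \<gamma>"
    and "affine_arclength_parametrized \<gamma>"
    and "\<mu> = affine_curvature \<gamma>"
    and "\<forall>s. \<mu> s \<noteq> 0"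
    and "\<alpha> \<in> {0<..1}"
    and "\<forall>s. X s = \<gamma> s + (\<alpha> / ((1 - \<alpha>)\<^sup>2 + \<mu> s * \<alpha>\<^sup>2)) *\<^sub>R
                     ((1 - \<alpha>) *\<^sub>R vderiv \<gamma> s + \<alpha> *\<^sub>R (vderiv ^^ 2) \<gamma> s)"
  shows "envelope (line_family \<gamma> \<alpha>) = range X \<and>
    (\<forall>s. (X has_vector_derivative 0) (at s) \<longleftrightarrow>
         deriv \<mu> s = (1 - \<alpha>) * ((1 - \<alpha>)\<^sup>2 + \<mu> s * \<alpha>\<^sup>2) / \<alpha> ^ 3)"
proof -
  define D where "D s = (1 - \<alpha>)\<^sup>2 + \<mu> s * \<alpha>\<^sup>2" for s
  define d where "d = line_direction \<gamma> \<alpha>"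
  define d' where "d' s = (1 - \<alpha>) *\<^sub>R (vderiv ^^ 2) \<gamma> s - (\<alpha> * \<mu> s) *\<^sub>R vderiv \<gamma> s" for s
  have \<alpha>: "\<alpha> > 0" using assms(6) by simp
  have "\<mu> s > 0" for s
    using affine_curvature_pos[OF assms(1-3)] assms(4,5) by simp
  then have D_nz: "D s \<noteq> 0" for s
    using \<alpha> by (simp add: D_def add_nonneg_pos less_imp_neq[symmetric])
  have unit: "bracket (vderiv \<gamma> s) ((vderiv ^^ 2) \<gamma> s) = 1" for s
    using assms(3) by (simp add: affine_arclength_parametrized_def)
  have unit': "bracket ((vderiv ^^ 2) \<gamma> s) (vderiv \<gamma> s) = -1" for s
    using unit[of s] bracket_swap[of "vderiv \<gamma> s" "(vderiv ^^ 2) \<gamma> s"] by simp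
  have \<gamma>1: "(\<gamma> has_vector_derivative vderiv \<gamma> s) (at s)" for s
    using smooth_curve_has_vector_derivative[OF assms(1), of 0 s] by simp
  have \<gamma>2: "(vderiv \<gamma> has_vector_derivative (vderiv ^^ 2) \<gamma> s) (at s)" for s
    using smooth_curve_has_vector_derivative[OF assms(1), of 1 s] by (simp add: eval_nat_numeral)
  have \<gamma>3: "((vderiv ^^ 2) \<gamma> has_vector_derivative - \<mu> s *\<^sub>R vderiv \<gamma> s) (at s)" for s
    using smooth_curve_has_vector_derivative[OF assms(1), of 2 s]
      affine_structure_equation[OF assms(1,3), of s] assms(4)
    by (simp add: eval_nat_numeral)
  have d_deriv: "(d has_vector_derivative d' s) (at s)" for s
  proof -
    have "d = (\<lambda>t. (1 - \<alpha>) *\<^sub>R vderiv \<gamma> t + \<alpha> *\<^sub>R (vderiv ^^ 2) \<gamma> t)"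
      by (simp add: d_def line_direction_def fun_eq_iff)
    moreover have "d' s = (1 - \<alpha>) *\<^sub>R (vderiv ^^ 2) \<gamma> s + \<alpha> *\<^sub>R (- \<mu> s *\<^sub>R vderiv \<gamma> s)"
      by (simp add: d'_def)
    ultimately show ?thesis
      by (simp only:) (intro has_vector_derivative_add
          bounded_linear.has_vector_derivative[OF bounded_linear_scaleR_right] \<gamma>2 \<gamma>3)
  qed
  have dd': "bracket (d s) (d' s) = D s" for s
    by (simp add: d_def line_direction_def d'_def D_def bracket_simps unit unit'
        power2_eq_square)
  have \<gamma>d: "bracket (vderiv \<gamma> s) (d s) = \<alpha>" for s
    by (simp add: d_def line_direction_def bracket_simps unit)
  have X_eq: "X = (\<lambda>s. \<gamma> s + (\<alpha> / D s) *\<^sub>R d s)"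
    using assms(7) by (simp add: D_def d_def line_direction_def fun_eq_iff)
  then have X: "X s = \<gamma> s + (\<alpha> / D s) *\<^sub>R d s" for s
    by simp

  have "line_family \<gamma> \<alpha> Y s = 0 \<and> (line_family \<gamma> \<alpha> Y has_real_derivative 0) (at s) \<longleftrightarrow> Y = X s"
    for Y s
    using envelope_conditions_iff[OF \<gamma>1 d_deriv, of s Y] D_nz[of s]
    by (simp add: line_family_def[abs_def] dd' \<gamma>d X flip: d_def)
  then have env: "envelope (line_family \<gamma> \<alpha>) = range X"
    by (auto simp: envelope_def)

  have "(X has_vector_derivative 0) (at s) \<longleftrightarrow> deriv \<mu> s = (1 - \<alpha>) * D s / \<alpha> ^ 3" for s
  proof -
    define c where "c = \<alpha> / D s"
    define c' where "c' = - (\<alpha> ^ 3 * deriv \<mu> s) / (D s)\<^sup>2"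
    define p where "p = 1 + (1 - \<alpha>) * c' - \<alpha> * \<mu> s * c"
    define q where "q = (1 - \<alpha>) * c + \<alpha> * c'"
    have \<mu>: "(\<mu> has_real_derivative deriv \<mu> s) (at s)"
      using affine_curvature_has_real_derivative[OF assms(1)] assms(4) by simp
    have c: "((\<lambda>t. \<alpha> / D t) has_real_derivative c') (at s)"
      unfolding D_def[abs_def] using D_nz[of s]
      by (auto intro!: derivative_eq_intros \<mu>
          simp: c'_def D_def power2_eq_square power3_eq_cube)
    have "(X has_vector_derivative vderiv \<gamma> s + (c *\<^sub>R d' s + c' *\<^sub>R d s)) (at s)"
      unfolding X_eq c_def
      by (intro has_vector_derivative_add \<gamma>1 has_vector_derivative_scaleR c d_deriv)
    moreover have "vderiv \<gamma> s + (c *\<^sub>R d' s + c' *\<^sub>R d s)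
        = p *\<^sub>R vderiv \<gamma> s + q *\<^sub>R (vderiv ^^ 2) \<gamma> s"
      by (simp add: d'_def d_def line_direction_def p_def q_def algebra_simps)
    ultimately have "(X has_vector_derivative p *\<^sub>R vderiv \<gamma> s + q *\<^sub>R (vderiv ^^ 2) \<gamma> s) (at s)"
      by simp
    then have "(X has_vector_derivative 0) (at s) \<longleftrightarrow>
        p *\<^sub>R vderiv \<gamma> s + q *\<^sub>R (vderiv ^^ 2) \<gamma> s = 0"
      by (metis vector_derivative_unique_at)
    also have "\<dots> \<longleftrightarrow> p = 0 \<and> q = 0"
      using bracket_eq_iff[of "vderiv \<gamma> s" "(vderiv ^^ 2) \<gamma> s"
          "p *\<^sub>R vderiv \<gamma> s + q *\<^sub>R (vderiv ^^ 2) \<gamma> s" 0]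
        bracket_scaleR_left[of 0 0]
      by (auto simp: bracket_simps unit unit')
    also have "\<dots> \<longleftrightarrow> deriv \<mu> s = (1 - \<alpha>) * D s / \<alpha> ^ 3"
      using singularity_equations_iff[of \<alpha> "\<mu> s" "deriv \<mu> s"] \<alpha> D_nz[of s]
      unfolding p_def q_def c_def c'_def D_def by simp
    finally show ?thesis .
  qed
  then show ?thesis
    using env by (simp add: D_def)
qed

end
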